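(* Observational dependence can rank confounded distractors above causal dimensions: a distractor can have higher mutual information with behavior actions than a causal state dimension, even though actions have zero causal effect on it (the distractor).
   Context: Setting: a Markov Decision Process with observation space $\mathcal{O}\subseteq\mathbb{R}^d$, action space $\mathcal{A}\subseteq\mathbb{R}^{d_a}$, a transition mechanism, a reward and a discount factor. The observation at time $t$ decomposes, unknown to the agent, as $\mathbf{o}_t=[\mathbf{s}^{\mathrm{c}}_t,\mathbf{s}^{\mathrm{d}}_t]$ with $d=d_c+d_d$. The causal component $\mathbf{s}^{\mathrm{c}}_t\in\mathbb{R}^{d_c}$ is causally downstream of the agent's actions $\mathbf{a}_t\in\mathcal{A}$; its coordinates are the causal (state) dimensions. The distractor component $\mathbf{s}^{\mathrm{d}}_t\in\mathbb{R}^{d_d}$ evolves autonomously; its coordinates are the distractors. Behavior actions are the actions as generated, without intervention, by the agent's behavior policy mechanism; mutual information is computed under the resulting observational distribution. Mutual information of two random variables is the Kullback–Leibler divergence of their joint law from the product of their marginal laws. Behavior actions and a distractor may share a latent common cause (a confounder); such a distractor is called confounded. $\mathrm{do}(a^{(j)}_t=u)$ is Pearl's do-operator: the mechanism generating the action coordinate $a^{(j)}_t$ is replaced by the value $u$, all other mechanisms being unchanged, so that edges from confounders into that action are severed. Observation dimension $i$ belongs to the agent's Causal Sphere of Influence if and only if there exist an action dimension $j$ and a horizon $h\ge 1$ such that $\mathbb{P}(o^{(i)}_{t+h}\mid \mathrm{do}(a^{(j)}_t=u))\neq\mathbb{P}(o^{(i)}_{t+h})$ for some intervention value $u$. That actions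 have zero causal effect on a dimension means that interventions on actions do not change its distribution, i.e. it lies outside the Sphere of Influence. "Can" expresses possibility: the assertion is that this situation occurs in some such model. The statement is qualitative and does not specify the time indices at which the mutual informations are taken. *)

theory Defs
  imports "HOL-Probability.Probability"
begin

text \<open>
  Vectors of dimension n are extensional functions on {..<n}, so that dimensions can be
  quantified over inside a formula.
\<close>

type_synonym vec = "nat \<Rightarrow> real"

abbreviation Rn :: "nat \<Rightarrow> vec measure" where
  "Rn n \<equiv> PiM {..<n} (\<lambda>_. borel)"

text \<open>
  Mutual information (in nats) of two random variables on a probability space, as an extended
  real: the Kullback-Leibler divergence of the joint law from the product of the marginal laws.
  The library's real-valued divergence is only meaningful when the joint law has a density with
  integrable logarithm; in all other cases the divergence is infinite.
\<close>

definition mutual_info ::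
  "'w measure \<Rightarrow> 'a measure \<Rightarrow> 'b measure \<Rightarrow> ('w \<Rightarrow> 'a) \<Rightarrow> ('w \<Rightarrow> 'b) \<Rightarrow> ereal" where
  "mutual_info M S T X Y =
    (let P = distr M S X \<Otimes>\<^sub>M distr M T Y;
         Q = distr M (S \<Otimes>\<^sub>M T) (\<lambda>w. (X w, Y w))
     in if absolutely_continuous P Q \<and> integrable Q (entropy_density (exp 1) P Q)
        then ereal (KL_divergence (exp 1) P Q) else \<infinity>)"

text \<open>
  A Markov decision process together with a behavior policy, given as a structural causal model.
  At time t a latent vector c is drawn (independently over time), the action is
  policy o c e, the next causal component is trans_c o a e' and the next
  distractor component is trans_d s c e'', where s is the current distractor component
  and e, e', e'' are independent exogenous noises.  One real-valued noise of arbitrary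
  law per mechanism and time suffices to realise any stochastic kernel.  The signature of
  trans_d expresses that distractors evolve autonomously: neither the action nor the causal
  component is an argument.  The latent vector may enter both the action and the distractor.
  Since it is drawn afresh at each time, the observation process is Markov given actions.
\<close>

record cmdp =
  dimc :: nat
  dimd :: nat
  dima :: nat
  diml :: nat
  obs_space :: "vec set"
  act_space :: "vec set"
  discount :: real
  reward :: "vec \<Rightarrow> vec \<Rightarrow> real"
  init_law :: "vec measure"
  latent_law :: "vec measure"
  policy_noise :: "real measure"
  causal_noise :: "real measure"
  distr_noise :: "real measure"
  policy :: "vec \<Rightarrow> vec \<Rightarrow> real \<Rightarrow> vec"
  trans_c :: "vec \<Rightarrow> vec \<Rightarrow> real \<Rightarrow> vec"
  trans_d :: "vec \<Rightarrow> vec \<Rightarrow> real \<Rightarrow> vec"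

definition dimo :: "cmdp \<Rightarrow> nat" where
  "dimo M = dimc M + dimd M"

definition join_obs :: "cmdp \<Rightarrow> vec \<Rightarrow> vec \<Rightarrow> vec" where
  "join_obs M sc sd = (\<lambda>i\<in>{..<dimo M}. if i < dimc M then sc i else sd (i - dimc M))"

definition distractor_part :: "cmdp \<Rightarrow> vec \<Rightarrow> vec" where
  "distractor_part M x = (\<lambda>i\<in>{..<dimd M}. x (dimc M + i))"

text \<open>
  The intervenable variables are coordinate j of the action at time t and coordinate k of the
  latent vector at time t.  An intervention assigns values to some of them; the mechanisms of
  exactly these variables are replaced by the assigned values.
\<close>

datatype var = Act nat nat | Lat nat nat

type_synonym intervention = "var \<Rightarrow> real option"

definition override :: "nat \<Rightarrow> (nat \<Rightarrow> real option) \<Rightarrow> vec \<Rightarrow> vec" where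
  "override n f v = (\<lambda>j\<in>{..<n}. case f j of None \<Rightarrow> v j | Some u \<Rightarrow> u)"

text \<open>
  An outcome consists of the initial observation and, for each time, of the latent vector and
  the noises of the policy, the causal and the distractor mechanism, all independent.
\<close>

type_synonym outcome = "vec \<times> (nat \<Rightarrow> vec \<times> real \<times> real \<times> real)"

definition exo :: "cmdp \<Rightarrow> outcome measure" where
  "exo M = init_law M \<Otimes>\<^sub>M
     PiM UNIV (\<lambda>_. latent_law M \<Otimes>\<^sub>M (policy_noise M \<Otimes>\<^sub>M (causal_noise M \<Otimes>\<^sub>M distr_noise M)))"

definition latent :: "cmdp \<Rightarrow> intervention \<Rightarrow> nat \<Rightarrow> outcome \<Rightarrow> vec" where
  "latent M I t w = override (diml M) (\<lambda>k. I (Lat t k)) (fst (snd w t))"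

definition choose_act :: "cmdp \<Rightarrow> intervention \<Rightarrow> nat \<Rightarrow> outcome \<Rightarrow> vec \<Rightarrow> vec" where
  "choose_act M I t w x =
     override (dima M) (\<lambda>j. I (Act t j)) (policy M x (latent M I t w) (fst (snd (snd w t))))"

primrec obs :: "cmdp \<Rightarrow> intervention \<Rightarrow> nat \<Rightarrow> outcome \<Rightarrow> vec" where
  "obs M I 0 w = fst w"
| "obs M I (Suc t) w =
     (let x = obs M I t w in
      join_obs M
        (trans_c M x (choose_act M I t w x) (fst (snd (snd (snd w t)))))
        (trans_d M (distractor_part M x) (latent M I t w) (snd (snd (snd (snd w t))))))"

definition act :: "cmdp \<Rightarrow> intervention \<Rightarrow> nat \<Rightarrow> outcome \<Rightarrow> vec" where
  "act M I t w = choose_act M I t w (obs M I t w)"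

definition obs_law :: "cmdp \<Rightarrow> intervention \<Rightarrow> nat \<Rightarrow> nat \<Rightarrow> real measure" where
  "obs_law M I t i = distr (exo M) borel (\<lambda>w. obs M I t w i)"

definition act_law :: "cmdp \<Rightarrow> intervention \<Rightarrow> nat \<Rightarrow> nat \<Rightarrow> real measure" where
  "act_law M I t j = distr (exo M) borel (\<lambda>w. act M I t w j)"

text \<open>
  The values u for which setting action coordinate j to u never leaves the action space; for a
  product action space these are exactly the elements of the j-th factor.
\<close>

definition action_values :: "cmdp \<Rightarrow> nat \<Rightarrow> real set" where
  "action_values M j = {u. \<forall>a\<in>act_space M. a(j := u) \<in> act_space M}"

definition action_effect :: "cmdp \<Rightarrow> nat \<Rightarrow> nat \<Rightarrow> nat \<Rightarrow> bool" where
  "action_effect M t h i \<longleftrightarrow>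
     (\<exists>j<dima M. \<exists>u\<in>action_values M j.
        obs_law M [Act t j \<mapsto> u] (t + h) i \<noteq> obs_law M Map.empty (t + h) i)"

definition sphere_of_influence :: "cmdp \<Rightarrow> nat set" where
  "sphere_of_influence M = {i. i < dimo M \<and> (\<exists>t. \<exists>h\<ge>1. action_effect M t h i)}"

text \<open>
  Some latent coordinate at time t is a cause both of the action at time t and of observation
  dimension i at time t + h.  Being a cause means that interventions on the latent
  coordinate change the law of the effect, for a set of values that the coordinate takes with
  positive probability (so an almost surely constant latent is no confounder).  For
  distractors and h \<ge> 1 neither effect is mediated by the other: the latent is independent
  of the observation at time t, and distractors do not depend on actions.
\<close>

definition latent_common_cause :: "cmdp \<Rightarrow> nat \<Rightarrow> nat \<Rightarrow> nat \<Rightarrow> bool" where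
  "latent_common_cause M t h i \<longleftrightarrow>
     (\<exists>k<diml M.
        (\<exists>j<dima M. \<not> (AE u in distr (latent_law M) borel (\<lambda>c. c k).
             act_law M [Lat t k \<mapsto> u] t j = act_law M Map.empty t j)) \<and>
        \<not> (AE u in distr (latent_law M) borel (\<lambda>c. c k).
             obs_law M [Lat t k \<mapsto> u] (t + h) i = obs_law M Map.empty (t + h) i))"

definition behavior_info :: "cmdp \<Rightarrow> nat \<Rightarrow> nat \<Rightarrow> nat \<Rightarrow> ereal" where
  "behavior_info M t h i =
     mutual_info (exo M) (Rn (dima M)) borel
       (act M Map.empty t) (\<lambda>w. obs M Map.empty (t + h) w i)"

locale confounded_mdp =
  fixes M :: cmdp
  assumes obs_space_sets: "obs_space M \<in> sets (Rn (dimo M))"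
    and act_space_sets: "act_space M \<in> sets (Rn (dima M))"
    and discount: "0 \<le> discount M" "discount M < 1"
    and reward_measurable:
      "(\<lambda>(x, a). reward M x a) \<in> borel_measurable (Rn (dimo M) \<Otimes>\<^sub>M Rn (dima M))"
    and init_law: "prob_space (init_law M)" "sets (init_law M) = sets (Rn (dimo M))"
      "AE x in init_law M. x \<in> obs_space M"
    and latent_law: "prob_space (latent_law M)" "sets (latent_law M) = sets (Rn (diml M))"
    and policy_noise: "prob_space (policy_noise M)" "sets (policy_noise M) = sets borel"
    and causal_noise: "prob_space (causal_noise M)" "sets (causal_noise M) = sets borel"
    and distr_noise: "prob_space (distr_noise M)" "sets (distr_noise M) = sets borel"
    and policy_measurable:
      "(\<lambda>(x, c, e). policy M x c e)
         \<in> Rn (dimo M) \<Otimes>\<^sub>M (Rn (diml M) \<Otimes>\<^sub>M borel) \<rightarrow>\<^sub>M Rn (dima M)"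
    and trans_c_measurable:
      "(\<lambda>(x, a, e). trans_c M x a e)
         \<in> Rn (dimo M) \<Otimes>\<^sub>M (Rn (dima M) \<Otimes>\<^sub>M borel) \<rightarrow>\<^sub>M Rn (dimc M)"
    and trans_d_measurable:
      "(\<lambda>(s, c, e). trans_d M s c e)
         \<in> Rn (dimd M) \<Otimes>\<^sub>M (Rn (diml M) \<Otimes>\<^sub>M borel) \<rightarrow>\<^sub>M Rn (dimd M)"
    and policy_closed:
      "\<And>x c e. x \<in> obs_space M \<Longrightarrow> c \<in> space (Rn (diml M)) \<Longrightarrow> policy M x c e \<in> act_space M"
    and trans_closed:
      "\<And>x a c e e'. x \<in> obs_space M \<Longrightarrow> a \<in> act_space M \<Longrightarrow> c \<in> space (Rn (diml M)) \<Longrightarrow>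
         join_obs M (trans_c M x a e) (trans_d M (distractor_part M x) c e') \<in> obs_space M"
    and causal_downstream: "{..<dimc M} \<subseteq> sphere_of_influence M"

end

theory Submission
  imports Defs
begin

text \<open>
  The model is a deadbeat regulator.  The causal component evolves by
  \<open>s' = s + a\<^sub>0\<close> and the policy always plays \<open>a\<^sub>0 = - s\<close>, so
  under the behavior policy the next causal component is the constant 0 and carries no information
  about the action, although setting \<open>a\<^sub>0\<close> by hand changes its law.  The second
  action coordinate copies a fair coin, the latent vector, which also is the next distractor.
  Hence the distractor depends on the action, its mutual information with it is positive, and
  no intervention on an action changes the distractor.
\<close>

section \<open>Mutual information of dependent and of independent pairs\<close>

text \<open>\<open>KL_gt_0\<close> speaks of measures of the form \<open>density M D\<close> with
  real-valued \<open>D\<close>. A real version of the Radon-Nikodym derivative brings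
  \<open>N\<close> into that form.\<close>

lemma (in information_space) KL_pos:
  assumes "prob_space N"
    and ac: "absolutely_continuous M N" "sets N = sets M"
    and int: "integrable N (entropy_density b M N)"
    and "N \<noteq> M"
  shows "0 < KL_divergence b M N"
proof -
  interpret N: prob_space N by fact
  obtain D where D: "D \<in> borel_measurable M" "AE x in M. RN_deriv M N x = ennreal (D x)"
      "AE x in N. 0 < D x" "\<And>x. 0 \<le> D x"
    using real_RN_deriv[OF N.finite_measure_axioms ac] by blast
  have "N = density M (RN_deriv M N)"
    using ac by (rule density_RN_deriv[symmetric])
  also have "\<dots> = density M D"
    using D by (auto intro!: density_cong)
  finally have N: "N = density M D" .
  \<comment> \<open>Absolute continuity carries the equation \<open>RN_deriv M N = D\<close> from
    \<open>M\<close>-almost everywhere to \<open>N\<close>-almost everywhere, so the entropy density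
    is \<open>log b (D x)\<close> there. Integrating it against \<open>N\<close> then amounts to
    integrating \<open>D x * log b (D x)\<close> against \<open>M\<close>.\<close>
  from absolutely_continuous_AE[OF ac(2,1) D(2)] D b_gt_1 ac measurable_entropy_density
  have "integrable N (\<lambda>x. log b (D x))"
    by (intro integrable_cong_AE[THEN iffD2, OF _ _ _ int])
       (auto simp: N entropy_density_def)
  with D have "integrable M (\<lambda>x. D x * log b (D x))"
    by (subst integrable_real_density[symmetric]) (auto simp: N[symmetric] comp_def)
  with assms D show ?thesis
    unfolding N by (intro KL_gt_0) auto
qed

text \<open>No integrability has to be checked: where the divergence is not given by
  \<open>KL_divergence\<close>, the value is infinite and hence positive.\<close>

lemma (in prob_space) mutual_info_pos:
  assumes [measurable]: "X \<in> M \<rightarrow>\<^sub>M S" "Y \<in> M \<rightarrow>\<^sub>M T"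
    and dep: "distr M (S \<Otimes>\<^sub>M T) (\<lambda>w. (X w, Y w)) \<noteq> distr M S X \<Otimes>\<^sub>M distr M T Y"
  shows "0 < mutual_info M S T X Y"
proof -
  define P where "P = distr M S X \<Otimes>\<^sub>M distr M T Y"
  define Q where "Q = distr M (S \<Otimes>\<^sub>M T) (\<lambda>w. (X w, Y w))"
  interpret X: prob_space "distr M S X" by (rule prob_space_distr) simp
  interpret Y: prob_space "distr M T Y" by (rule prob_space_distr) simp
  interpret XY: pair_prob_space "distr M S X" "distr M T Y" ..
  interpret P: information_space P "exp 1"
    unfolding P_def by unfold_locales simp
  have "prob_space Q"
    unfolding Q_def by (rule prob_space_distr) simp
  moreover have "Q \<noteq> P"
    using dep by (simp add: P_def Q_def)
  moreover have "sets Q = sets P"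
    unfolding P_def Q_def sets_distr by (rule sets_pair_measure_cong) simp_all
  ultimately have "0 < KL_divergence (exp 1) P Q"
    if "absolutely_continuous P Q" "integrable Q (entropy_density (exp 1) P Q)"
    using that by (intro P.KL_pos) auto
  then show ?thesis
    by (auto simp: mutual_info_def Let_def P_def Q_def)
qed

text \<open>Here the finite branch of the definition must be secured. The derivative of a law with
  respect to itself is 1 almost everywhere, so the entropy density vanishes and is
  integrable.\<close>

lemma (in prob_space) mutual_info_indep:
  assumes [measurable]: "X \<in> M \<rightarrow>\<^sub>M S" "Y \<in> M \<rightarrow>\<^sub>M T"
    and indep: "distr M (S \<Otimes>\<^sub>M T) (\<lambda>w. (X w, Y w)) = distr M S X \<Otimes>\<^sub>M distr M T Y"
  shows "mutual_info M S T X Y = 0"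
proof -
  define P where "P = distr M S X \<Otimes>\<^sub>M distr M T Y"
  have Q: "distr M (S \<Otimes>\<^sub>M T) (\<lambda>w. (X w, Y w)) = P"
    using indep by (simp add: P_def)
  interpret P: prob_space P
    unfolding Q[symmetric] by (rule prob_space_distr) simp
  have "AE x in P. 1 = RN_deriv P P x"
    by (rule P.RN_deriv_unique) (auto simp: density_1)
  then have "AE x in P. entropy_density (exp 1) P P x = 0"
    by eventually_elim (simp add: entropy_density_def)
  then have "integrable P (entropy_density (exp 1) P P)"
    by (subst integrable_cong_AE[where g = "\<lambda>_. 0"]) auto
  then show ?thesis
    by (simp add: mutual_info_def Let_def P_def[symmetric] Q P.KL_same_eq_0
        absolutely_continuous_def zero_ereal_def)
qed

lemma (in prob_space) distr_pair_const:
  assumes [measurable]: "X \<in> M \<rightarrow>\<^sub>M S" and c: "c \<in> space T"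
  shows "distr M (S \<Otimes>\<^sub>M T) (\<lambda>w. (X w, c)) = distr M S X \<Otimes>\<^sub>M distr M T (\<lambda>_. c)"
proof (rule pair_measure_eqI[symmetric])
  fix A B assume "A \<in> sets (distr M S X)" "B \<in> sets (distr M T (\<lambda>_. c))"
  then have [measurable]: "A \<in> sets S" "B \<in> sets T"
    by auto
  have "emeasure (distr M (S \<Otimes>\<^sub>M T) (\<lambda>w. (X w, c))) (A \<times> B) =
      emeasure M ((\<lambda>w. (X w, c)) -` (A \<times> B) \<inter> space M)"
    using c by (intro emeasure_distr) auto
  also have "(\<lambda>w. (X w, c)) -` (A \<times> B) \<inter> space M = (if c \<in> B then X -` A \<inter> space M else {})"
    by auto
  finally show "emeasure (distr M S X) A * emeasure (distr M T (\<lambda>_. c)) B =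
      emeasure (distr M (S \<Otimes>\<^sub>M T) (\<lambda>w. (X w, c))) (A \<times> B)"
    using c by (simp add: emeasure_distr split: split_indicator)
\<comment> \<open>\<open>distr_const\<close> would turn the law of the constant into a
  \<open>return\<close>, to which \<open>prob_space_distr\<close> does not apply.\<close>
qed (use c in \<open>auto intro!: prob_space_imp_sigma_finite prob_space_distr simp del: distr_const\<close>)

lemma (in pair_prob_space) distr_snd: "distr (M1 \<Otimes>\<^sub>M M2) M2 snd = M2"
proof -
  have "distr (M1 \<Otimes>\<^sub>M M2) M2 snd = distr (M2 \<Otimes>\<^sub>M M1) M2 fst"
    by (subst distr_pair_swap) (simp add: distr_distr comp_def case_prod_beta)
  then show ?thesis
    by (simp add: M1.distr_pair_fst)
qed

section \<open>The fair coin as a law on the reals\<close>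

definition coin :: "real measure" where
  "coin = distr (measure_pmf (bernoulli_pmf (1 / 2))) borel of_bool"

lemma sets_coin [measurable_cong, simp]: "sets coin = sets borel"
  and space_coin [simp]: "space coin = UNIV"
  by (simp_all add: coin_def)

interpretation coin: prob_space coin
  unfolding coin_def by (intro prob_space.prob_space_distr) (auto simp: prob_space_measure_pmf)

lemma coin_zero: "measure coin {0} = 1 / 2"
proof -
  have "of_bool -` {0 :: real} = {False}"
    by auto
  then show ?thesis
    by (simp add: coin_def measure_distr measure_pmf_single)
qed

text \<open>A point mass gives \<open>{0}\<close> measure 0 or 1, never 1/2. This separates
  intervened from unintervened laws, both for the action effect and for the confounder.\<close>

lemma coin_neq_return: "coin \<noteq> return borel u"
proof
  assume "coin = return borel u"
  then have "measure (return borel u) {0 :: real} = 1 / 2"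
    using coin_zero by simp
  then show False
    by (simp add: measure_return split: split_indicator_asm)
qed

lemma distr_PiM_coin: "i \<in> I \<Longrightarrow> distr (PiM I (\<lambda>_. coin)) borel (\<lambda>x. x i) = coin"
  using distr_PiM_component[of I "\<lambda>_. coin" i] coin.prob_space_axioms
  by (simp cong: distr_cong)

section \<open>The regulator model\<close>

text \<open>With the full spaces, closure is immediate and every real is an admissible value of
  either action coordinate.\<close>

definition regulator :: cmdp where
  "regulator = \<lparr>
     dimc = 1, dimd = 1, dima = 2, diml = 1,
     obs_space = space (Rn 2), act_space = space (Rn 2),
     discount = 0, reward = (\<lambda>_ _. 0),
     init_law = PiM {..<2::nat} (\<lambda>_. coin), latent_law = PiM {..<1::nat} (\<lambda>_. coin),
     policy_noise = coin, causal_noise = coin, distr_noise = coin,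
     policy = (\<lambda>x c e. \<lambda>j\<in>{..<2}. if j = 0 then - x 0 else c 0),
     trans_c = (\<lambda>x a e. \<lambda>_\<in>{..<1}. x 0 + a 0),
     trans_d = (\<lambda>s c e. \<lambda>_\<in>{..<1}. c 0)\<rparr>"

lemma regulator_sel [simp]:
  "dimc regulator = 1" "dimd regulator = 1" "dima regulator = 2" "diml regulator = 1"
  "dimo regulator = 2"
  "obs_space regulator = space (Rn 2)" "act_space regulator = space (Rn 2)"
  "discount regulator = 0" "reward regulator = (\<lambda>_ _. 0)"
  "init_law regulator = PiM {..<2::nat} (\<lambda>_. coin)" "latent_law regulator = PiM {..<1::nat} (\<lambda>_. coin)"
  "policy_noise regulator = coin" "causal_noise regulator = coin" "distr_noise regulator = coin"
  "policy regulator = (\<lambda>x c e. \<lambda>j\<in>{..<2}. if j = 0 then - x 0 else c 0)"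
  "trans_c regulator = (\<lambda>x a e. \<lambda>_\<in>{..<1}. x 0 + a 0)"
  "trans_d regulator = (\<lambda>s c e. \<lambda>_\<in>{..<1}. c 0)"
  by (simp_all add: regulator_def dimo_def)

lemma latent_regulator:
  "latent regulator I t w 0 = (case I (Lat t 0) of None \<Rightarrow> fst (snd w t) 0 | Some u \<Rightarrow> u)"
  by (simp add: latent_def override_def)

lemma act_regulator:
  "act regulator I t w = (\<lambda>j\<in>{..<2}. case I (Act t j) of
     None \<Rightarrow> if j = 0 then - obs regulator I t w 0 else latent regulator I t w 0
   | Some u \<Rightarrow> u)"
  by (auto simp: act_def choose_act_def override_def fun_eq_iff split: option.splits)

lemma obs_regulator_causal:
  "obs regulator I (Suc t) w 0 = obs regulator I t w 0 + act regulator I t w 0"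
  by (simp add: Let_def join_obs_def act_def)

lemma obs_regulator_distractor: "obs regulator I (Suc t) w 1 = latent regulator I t w 0"
  by (simp add: Let_def join_obs_def)

lemma prob_space_step_noise: "prob_space (PiM {..<1::nat} (\<lambda>_. coin) \<Otimes>\<^sub>M (coin \<Otimes>\<^sub>M (coin \<Otimes>\<^sub>M coin)))"
  by (intro prob_space_pair prob_space_PiM coin.prob_space_axioms)

lemma exo_regulator:
  "exo regulator = PiM {..<2::nat} (\<lambda>_. coin) \<Otimes>\<^sub>M
     PiM UNIV (\<lambda>_. PiM {..<1::nat} (\<lambda>_. coin) \<Otimes>\<^sub>M (coin \<Otimes>\<^sub>M (coin \<Otimes>\<^sub>M coin)))"
  by (simp add: exo_def)

interpretation exo: prob_space "exo regulator"
  unfolding exo_regulator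
  by (intro prob_space_pair prob_space_PiM coin.prob_space_axioms prob_space_step_noise)

text \<open>Measurability goals can thus be solved over plain products of Borel spaces.\<close>

lemma sets_exo_regulator [measurable_cong]:
  "sets (exo regulator) = sets (Rn 2 \<Otimes>\<^sub>M PiM UNIV (\<lambda>_. Rn 1 \<Otimes>\<^sub>M (borel \<Otimes>\<^sub>M (borel \<Otimes>\<^sub>M borel))))"
  unfolding exo_regulator by (intro sets_pair_measure_cong sets_PiM_cong) auto

lemma distr_init: "distr (exo regulator) borel (\<lambda>w. fst w 0) = coin"
proof -
  let ?I = "PiM {..<2::nat} (\<lambda>_. coin)"
    and ?N = "PiM (UNIV :: nat set) (\<lambda>_. PiM {..<1::nat} (\<lambda>_. coin) \<Otimes>\<^sub>M (coin \<Otimes>\<^sub>M (coin \<Otimes>\<^sub>M coin)))"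
  interpret N: prob_space ?N
    by (intro prob_space_PiM prob_space_step_noise)
  have "distr (exo regulator) borel (\<lambda>w. fst w 0) =
      distr (distr (?I \<Otimes>\<^sub>M ?N) ?I fst) borel (\<lambda>x. x 0)"
    by (subst distr_distr) (auto simp: exo_regulator comp_def intro!: distr_cong)
  then show ?thesis
    unfolding N.distr_pair_fst by (simp add: distr_PiM_coin)
qed

lemma distr_latent: "distr (exo regulator) borel (\<lambda>w. fst (snd w t) 0) = coin"
proof -
  let ?I = "PiM {..<2::nat} (\<lambda>_. coin)" and ?L = "PiM {..<1::nat} (\<lambda>_. coin)"
    and ?E = "coin \<Otimes>\<^sub>M (coin \<Otimes>\<^sub>M coin)"
  let ?N = "PiM (UNIV :: nat set) (\<lambda>_. ?L \<Otimes>\<^sub>M ?E)"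
  interpret N: prob_space ?N
    by (intro prob_space_PiM prob_space_step_noise)
  interpret I: prob_space ?I
    by (intro prob_space_PiM coin.prob_space_axioms)
  interpret E: prob_space ?E
    by (intro prob_space_pair coin.prob_space_axioms)
  interpret IN: pair_prob_space ?I ?N ..
  \<comment> \<open>The projection is split into four: noise sequence, time \<open>t\<close>, latent
    vector, coordinate 0. Each one extracts a factor of a product law.\<close>
  have "distr (exo regulator) borel (\<lambda>w. fst (snd w t) 0) =
      distr (distr (distr (distr (?I \<Otimes>\<^sub>M ?N) ?N snd) (?L \<Otimes>\<^sub>M ?E) (\<lambda>f. f t)) ?L fst) borel (\<lambda>c. c 0)"
    by (simp add: distr_distr comp_def exo_regulator cong: distr_cong)
  then show ?thesis
    unfolding IN.distr_snd distr_PiM_component[OF prob_space_step_noise UNIV_I] E.distr_pair_fst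
    by (simp add: distr_PiM_coin)
qed

section \<open>Effects of interventions in the regulator\<close>

lemma action_effect_regulator: "action_effect regulator 0 1 0"
proof -
  \<comment> \<open>The recursion is stated at \<open>Suc t\<close>; folding makes it match the
    literal time 1.\<close>
  note obs_1 = obs_regulator_causal[of _ 0, folded One_nat_def]
  \<comment> \<open>Forcing the action 0 keeps the state at its initial coin toss, whereas the
    policy would cancel it to 0.\<close>
  have "obs_law regulator [Act 0 0 \<mapsto> 0] 1 0 = coin"
    using distr_init by (simp add: obs_law_def obs_1 act_regulator del: One_nat_def)
  moreover have "obs_law regulator Map.empty 1 0 = return borel 0"
    by (simp add: obs_law_def obs_1 act_regulator del: One_nat_def)
  moreover have "0 \<in> action_values regulator 0"
    by (auto simp: action_values_def space_PiM)
  ultimately show ?thesis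
    unfolding action_effect_def
    by (intro exI[of _ 0] conjI bexI[of _ 0]) (simp_all add: coin_neq_return del: One_nat_def)
qed

text \<open>From time 1 on the distractor is the previous latent value, which no \<open>Act\<close>
  intervention touches, so the two observations agree outcome by outcome.\<close>

lemma distractor_notin_sphere: "1 \<notin> sphere_of_influence regulator"
proof -
  have "obs_law regulator [Act t j \<mapsto> u] (t + h) 1 = obs_law regulator Map.empty (t + h) 1"
    if "1 \<le> h" for t j u h
    using that by (cases h) (simp_all add: obs_law_def obs_regulator_distractor latent_regulator
        del: obs.simps flip: One_nat_def)
  then show ?thesis
    unfolding sphere_of_influence_def action_effect_def by blast
qed

text \<open>Fixing the latent coin at \<open>u\<close> turns both the copying action coordinate 1
  and the next distractor into the constant \<open>u\<close>, while their natural law is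
  \<open>coin\<close>.\<close>

lemma latent_common_cause_regulator: "latent_common_cause regulator 0 1 1"
proof -
  have c: "distr (latent_law regulator) borel (\<lambda>c. c 0) = coin"
    by (simp add: distr_PiM_coin)
  have "act_law regulator [Lat 0 0 \<mapsto> u] 0 1 \<noteq> act_law regulator Map.empty 0 1"
    "obs_law regulator [Lat 0 0 \<mapsto> u] (0 + 1) 1 \<noteq> obs_law regulator Map.empty (0 + 1) 1" for u
    using coin_neq_return[of u]
    by (simp_all add: act_law_def obs_law_def act_regulator
        obs_regulator_distractor[of _ 0, folded One_nat_def] latent_regulator distr_latent eq_commute
        del: One_nat_def)
  \<comment> \<open>The laws differ for every \<open>u\<close>, and a predicate that is false
    everywhere cannot hold almost surely under a probability measure.\<close>
  then have "\<not> (AE u in coin. act_law regulator [Lat 0 0 \<mapsto> u] 0 1 = act_law regulator Map.empty 0 1)"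
    "\<not> (AE u in coin. obs_law regulator [Lat 0 0 \<mapsto> u] (0 + 1) 1 = obs_law regulator Map.empty (0 + 1) 1)"
    by simp_all
  then have "\<exists>j<dima regulator. \<not> (AE u in coin.
      act_law regulator [Lat 0 0 \<mapsto> u] 0 j = act_law regulator Map.empty 0 j)"
    "\<not> (AE u in coin. obs_law regulator [Lat 0 0 \<mapsto> u] (0 + 1) 1 = obs_law regulator Map.empty (0 + 1) 1)"
    by (auto intro!: exI[of _ 1])
  then show ?thesis
    unfolding latent_common_cause_def by (intro exI[of _ 0]) (unfold c, simp)
qed

lemma confounded_mdp_regulator: "confounded_mdp regulator"
proof (rule confounded_mdp.intro)
  show "{..<dimc regulator} \<subseteq> sphere_of_influence regulator"
    using action_effect_regulator by (auto simp: sphere_of_influence_def)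
  show "prob_space (init_law regulator)" "prob_space (latent_law regulator)"
    by (auto intro!: prob_space_PiM coin.prob_space_axioms)
  show "sets (init_law regulator) = sets (Rn (dimo regulator))"
    "sets (latent_law regulator) = sets (Rn (diml regulator))"
    unfolding regulator_sel by (intro sets_PiM_cong refl sets_coin)+
  show "AE x in init_law regulator. x \<in> obs_space regulator"
    by (auto simp: space_PiM intro!: AE_I2)
  show "(\<lambda>(x, c, e). policy regulator x c e)
      \<in> Rn (dimo regulator) \<Otimes>\<^sub>M (Rn (diml regulator) \<Otimes>\<^sub>M borel) \<rightarrow>\<^sub>M Rn (dima regulator)"
    unfolding regulator_sel case_prod_beta by measurable
qed (auto simp: coin.prob_space_axioms space_PiM join_obs_def case_prod_beta
  intro!: measurable_restrict)

section \<open>Mutual information with the behavior action\<close>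

lemma act_regulator_measurable [measurable]:
  "act regulator Map.empty 0 \<in> exo regulator \<rightarrow>\<^sub>M Rn 2"
proof -
  have "act regulator Map.empty 0 =
      (\<lambda>w. \<lambda>j\<in>{..<2}. if j = 0 then - fst w 0 else fst (snd w 0) 0)"
    by (simp add: act_regulator latent_regulator fun_eq_iff)
  then show ?thesis
    by (simp add: measurable_restrict)
qed

lemma behavior_info_causal: "behavior_info regulator 0 1 0 = 0"
proof -
  have "(\<lambda>w. obs regulator Map.empty (0 + 1) w 0) = (\<lambda>_. 0)"
    by (simp add: obs_regulator_causal act_regulator del: obs.simps)
  then show ?thesis
    unfolding behavior_info_def
    by (simp add: exo.mutual_info_indep exo.distr_pair_const del: obs.simps add_0 One_nat_def)
qed

text \<open>Action coordinate 1 and the distractor are the same coin toss. Both being 0 has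
  probability 1/2, but the product of the marginals would give 1/4.\<close>

lemma behavior_info_distractor: "0 < behavior_info regulator 0 1 1"
proof -
  let ?a = "act regulator Map.empty 0" and ?c = "\<lambda>w :: outcome. fst (snd w 0) 0"
  have o: "(\<lambda>w. obs regulator Map.empty (0 + 1) w 1) = ?c"
    by (simp add: obs_regulator_distractor[of _ 0, folded One_nat_def] latent_regulator
        flip: One_nat_def)
  have p: "exo.prob (?c -` {0} \<inter> space (exo regulator)) = 1 / 2"
    unfolding coin_zero[symmetric]
    by (subst distr_latent[of 0, symmetric], subst measure_distr) auto
  let ?S = "distr (exo regulator) (Rn 2) ?a" and ?T = "distr (exo regulator) borel ?c"
    and ?A = "{a \<in> space (Rn 2). a 1 = 0}"
  interpret S: prob_space ?S by (rule exo.prob_space_distr) simp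
  interpret T: prob_space ?T by (rule exo.prob_space_distr) simp
  interpret ST: pair_prob_space ?S ?T ..
  have a: "?a w \<in> space (Rn 2)" "?a w 1 = ?c w" if "w \<in> space (exo regulator)" for w
    using that measurable_space[OF act_regulator_measurable]
    by (simp_all add: act_regulator latent_regulator del: One_nat_def)
  have "distr (exo regulator) (Rn 2 \<Otimes>\<^sub>M borel) (\<lambda>w. (?a w, ?c w)) \<noteq> ?S \<Otimes>\<^sub>M ?T"
  proof
    assume eq: "distr (exo regulator) (Rn 2 \<Otimes>\<^sub>M borel) (\<lambda>w. (?a w, ?c w)) = ?S \<Otimes>\<^sub>M ?T"
    have "measure (?S \<Otimes>\<^sub>M ?T) (?A \<times> {0}) =
        exo.prob ((\<lambda>w. (?a w, ?c w)) -` (?A \<times> {0}) \<inter> space (exo regulator))"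
      unfolding eq[symmetric] by (intro measure_distr) auto
    also have "(\<lambda>w. (?a w, ?c w)) -` (?A \<times> {0}) \<inter> space (exo regulator) =
        ?c -` {0} \<inter> space (exo regulator)"
      using a by auto
    finally have "measure (?S \<Otimes>\<^sub>M ?T) (?A \<times> {0}) = 1 / 2"
      using p by simp
    moreover have "measure ?S ?A = exo.prob (?a -` ?A \<inter> space (exo regulator))"
      by (intro measure_distr) auto
    moreover have "?a -` ?A \<inter> space (exo regulator) = ?c -` {0} \<inter> space (exo regulator)"
      using a by auto
    moreover have "measure ?T {0} = 1 / 2"
      using p by (simp add: measure_distr)
    moreover have "measure (?S \<Otimes>\<^sub>M ?T) (?A \<times> {0}) = measure ?S ?A * measure ?T {0}"
      by (simp add: measure_def T.emeasure_pair_measure_Times enn2real_mult)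
    ultimately show False
      using p by simp
  qed
  then show ?thesis
    unfolding behavior_info_def o by (intro exo.mutual_info_pos) auto
qed

theorem proposition3p2:
  shows "\<exists>M t h i i'.
    confounded_mdp M \<and> h \<ge> 1 \<and>
    i < dimc M \<and> action_effect M t h i \<and>
    dimc M \<le> i' \<and> i' < dimo M \<and> latent_common_cause M t h i' \<and>
    i' \<notin> sphere_of_influence M \<and>
    behavior_info M t h i < behavior_info M t h i'"
proof (intro exI conjI)
  \<comment> \<open>Proving this conjunct first instantiates all existential witnesses.\<close>
  show "behavior_info regulator 0 1 0 < behavior_info regulator 0 1 1"
    using behavior_info_causal behavior_info_distractor by simp
qed (simp_all add: confounded_mdp_regulator action_effect_regulator
  latent_common_cause_regulator distractor_notin_sphere del: One_nat_def)

end
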